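(* Let $\mathcal{G}_1=(V_1,E_1)$ be a finite $d_1$-regular graph with normalized adjacency matrix $A_1$, and let $\mathcal{G}_2=(V_2,E_2)$ be a finite $d_2$-regular graph with normalized adjacency matrix $A_2$. Put $|V_i|=n_i$ for $i=1,2$. Then the matrix wreath product $$\left(\frac{d_1}{d_1+d_2}A_1\right)\wr\left(\frac{d_2}{d_1+d_2}A_2\right)$$ is the normalized adjacency matrix of the graph wreath product $\mathcal{G}_1\wr\mathcal{G}_2$ (with respect to a suitable ordering of its $n_1n_2^{n_1}$ vertices).
   Context: Wreath product of matrices: for $A\in\mathcal{M}_n(\mathbb{C})$ and $B\in\mathcal{M}_m(\mathbb{C})$, $$A\wr B = I_m^{\otimes n}\otimes A+\sum_{i=1}^n I_m^{\otimes (i-1)}\otimes B\otimes I_m^{\otimes (n-i)}\otimes C_i,$$ a square matrix of order $nm^n$. Here $\otimes$ is the Kronecker product ($M\otimes N$ is the block matrix with blocks $m_{ij}N$), $I_m^{\otimes r}$ is the $r$-fold Kronecker power, with $I_m^{\otimes 0}=1$, and $C_i\in\mathcal{M}_n(\mathbb{C})$ has entry $1$ in position $(i,i)$ and $0$ elsewhere. Graphs are finite and undirected; $\sim$ denotes adjacency. The normalized adjacency matrix of a $d$-regular graph (with $d\geq 1$) is the square matrix, indexed by the vertices in some fixed ordering, whose $(i,j)$ entry is the number of edges connecting the $i$-th and $j$-th vertex, divided by $d$ (so each row sums to $1$). Wreath product of graphs: $\mathcal{G}_1\wr\mathcal{G}_2$ has vertex set $V_2^{V_1}\times V_1=\{(f,v):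 f:V_1\to V_2,\ v\in V_1\}$, and $(f,v)\sim(f',v')$ if (1) either $v=v'=:\overline{v}$, $f(w)=f'(w)$ for every $w\neq\overline{v}$, and $f(\overline{v})\sim f'(\overline{v})$ in $\mathcal{G}_2$; (2) or $f(w)=f'(w)$ for every $w\in V_1$, and $v\sim v'$ in $\mathcal{G}_1$. If multiple edges or loops are present, every edge $f(\overline v)\sim f'(\overline v)$ of $\mathcal{G}_2$ gives one edge of type (1) and every edge $v\sim v'$ of $\mathcal{G}_1$ gives one edge of type (2), and multiplicities are added. The graph $\mathcal{G}_1\wr\mathcal{G}_2$ is $(d_1+d_2)$-regular. *)

theory Defs
  imports "Jordan_Normal_Form.Matrix" "HOL-Library.FuncSet" Complex_Main
begin

definition kron :: "complex mat \<Rightarrow> complex mat \<Rightarrow> complex mat" where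
  "kron M N = mat (dim_row M * dim_row N) (dim_col M * dim_col N)
     (\<lambda>(i, j). M $$ (i div dim_row N, j div dim_col N) * N $$ (i mod dim_row N, j mod dim_col N))"

primrec kron_power :: "complex mat \<Rightarrow> nat \<Rightarrow> complex mat" where
  "kron_power M 0 = 1\<^sub>m 1"
| "kron_power M (Suc r) = kron M (kron_power M r)"

(* Indices start at 0: diag_unit_mat n i is the matrix written C_{i+1} in 1-based notation. *)
definition diag_unit_mat :: "nat \<Rightarrow> nat \<Rightarrow> complex mat" where
  "diag_unit_mat n i = mat n n (\<lambda>(j, k). if j = i \<and> k = i then 1 else 0)"

(* Meant for square A of order n and square B of order m.  Matrices of varying dimension have no
   additive type class, so the sum over i < n (1-based: i + 1) is taken entry by entry. *)
definition wreath_mat :: "complex mat \<Rightarrow> complex mat \<Rightarrow> complex mat" where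
  "wreath_mat A B =
     (let n = dim_row A; m = dim_row B; I = 1\<^sub>m m;
          S = (\<lambda>i. kron (kron (kron (kron_power I i) B) (kron_power I (n - 1 - i))) (diag_unit_mat n i))
      in kron (kron_power I n) A
         + mat (n * m ^ n) (n * m ^ n) (\<lambda>jk. \<Sum>i<n. S i $$ jk))"

(* Undirected graphs with loops and multiple edges; a loop is an edge with a single endpoint. *)
record ('v, 'e) multigraph =
  verts :: "'v set"
  edges :: "'e set"
  ends :: "'e \<Rightarrow> 'v set"

definition finite_multigraph :: "('v, 'e) multigraph \<Rightarrow> bool" where
  "finite_multigraph G \<longleftrightarrow> finite (verts G) \<and> finite (edges G) \<and>
     (\<forall>e\<in>edges G. \<exists>u\<in>verts G. \<exists>v\<in>verts G. ends G e = {u, v})"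

definition edge_mult :: "('v, 'e) multigraph \<Rightarrow> 'v \<Rightarrow> 'v \<Rightarrow> nat" where
  "edge_mult G u v = card {e \<in> edges G. ends G e = {u, v}}"

(* A loop contributes 1 to the degree, so that the rows of the normalized adjacency matrix,
   whose diagonal entries count each loop once, sum to 1. *)
definition regular :: "('v, 'e) multigraph \<Rightarrow> nat \<Rightarrow> bool" where
  "regular G d \<longleftrightarrow> (\<forall>v\<in>verts G. card {e \<in> edges G. v \<in> ends G e} = d)"

(* The list vs is the ordering of the vertices. *)
definition norm_adj_mat :: "('v, 'e) multigraph \<Rightarrow> nat \<Rightarrow> 'v list \<Rightarrow> complex mat" where
  "norm_adj_mat G d vs = mat (length vs) (length vs)
     (\<lambda>(i, j). of_nat (edge_mult G (vs ! i) (vs ! j)) / of_nat d)"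

(* An edge of the wreath product is a pair of its endpoint set and the edge it comes from:
   Inl e for an edge e of G2 (type 1), Inr e for an edge e of G1 (type 2).  Thus parallel edges
   of a factor give parallel edges, and coinciding edges of the two types add up. *)
definition wreath_graph :: "('a, 'e) multigraph \<Rightarrow> ('b, 'f) multigraph \<Rightarrow>
    (('a \<Rightarrow> 'b) \<times> 'a, (('a \<Rightarrow> 'b) \<times> 'a) set \<times> ('f + 'e)) multigraph" where
  "wreath_graph G1 G2 =
     \<lparr> verts = (verts G1 \<rightarrow>\<^sub>E verts G2) \<times> verts G1,
       edges =
         {({(f, v), (f', v)}, Inl e) | f f' v e.
            f \<in> verts G1 \<rightarrow>\<^sub>E verts G2 \<and> f' \<in> verts G1 \<rightarrow>\<^sub>E verts G2 \<and> v \<in> verts G1 \<and>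
            (\<forall>w\<in>verts G1. w \<noteq> v \<longrightarrow> f w = f' w) \<and> e \<in> edges G2 \<and> ends G2 e = {f v, f' v}} \<union>
         {({(f, v), (f, v')}, Inr e) | f v v' e.
            f \<in> verts G1 \<rightarrow>\<^sub>E verts G2 \<and> v \<in> verts G1 \<and> v' \<in> verts G1 \<and>
            e \<in> edges G1 \<and> ends G1 e = {v, v'}},
       ends = fst \<rparr>"

end

theory Submission
  imports Defs
begin

text \<open>
  Order the vertices \<open>(f, v)\<close> of the wreath product so that the position \<open>k\<close> encodes
  \<open>v\<close> as the vertex number \<open>k mod n\<^sub>1\<close> and \<open>f\<close> by the base-\<open>n\<^sub>2\<close> digits of \<open>k div n\<^sub>1\<close>, the first
  vertex of \<open>G\<^sub>1\<close> carrying the most significant digit. In these coordinates the Kronecker factors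
  of the matrix wreath product act digitwise: the first summand is nonzero only where all digits
  agree, and the \<open>i\<close>-th term of the sum only where the current vertex is the \<open>i\<close>-th one and all
  other digits agree. These are exactly the two adjacency rules.
\<close>

section \<open>Digits\<close>

definition digit :: "nat \<Rightarrow> nat \<Rightarrow> nat \<Rightarrow> nat" where
  "digit m t q = q div m ^ t mod m"

text \<open>Induction on \<open>s\<close>: a residue modulo \<open>m ^ Suc s\<close> splits into its
  top digit and the residue modulo \<open>m ^ s\<close>, and each of the two can be recovered from
  it.\<close>

lemma mod_power_eq_iff_digits:
  "q mod m ^ s = q' mod m ^ s \<longleftrightarrow> (\<forall>t<s. digit m t q = digit m t q')"
proof (induction s)
  case 0
  then show ?case by simp
next
  case (Suc s)
  have split: "x mod m ^ Suc s = m ^ s * digit m s x + x mod m ^ s" for x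
    unfolding digit_def power_Suc2 by (rule mod_mult2_eq)
  have "q mod m ^ Suc s = q' mod m ^ Suc s \<longleftrightarrow>
    q mod m ^ s = q' mod m ^ s \<and> digit m s q = digit m s q'"
  proof
    assume eq: "q mod m ^ Suc s = q' mod m ^ Suc s"
    have "q mod m ^ s = q' mod m ^ s"
      using arg_cong[OF eq, of "\<lambda>x. x mod m ^ s"] unfolding split by simp
    moreover have "digit m s q = digit m s q'"
    \<comment> \<open>For \<open>m = 0\<close> no positive factor \<open>m ^ s\<close> can be
      cancelled. If \<open>s = 0\<close>, then \<open>digit 0 0 q\<close> is \<open>q\<close>
      itself, because \<open>q mod 0 = q\<close>; if \<open>s > 0\<close>, division by
      \<open>0 ^ s = 0\<close> makes both digits zero.\<close>
    proof (cases "m = 0")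
      case True
      with calculation eq show ?thesis
        by (cases s) (auto simp: digit_def)
    next
      case False
      with calculation eq show ?thesis unfolding split by simp
    qed
    ultimately show "q mod m ^ s = q' mod m ^ s \<and> digit m s q = digit m s q'" ..
  qed (simp only: split)
  with Suc.IH show ?case by (auto simp: less_Suc_eq)
qed

lemma eq_iff_digits:
  assumes "q < m ^ s" and "q' < m ^ s"
  shows "q = q' \<longleftrightarrow> (\<forall>t<s. digit m t q = digit m t q')"
  using mod_power_eq_iff_digits[of q m s q'] assms by simp

text \<open>Nested \<open>kron\<close> indices produce the form \<open>q div m ^ s div m\<close>. It
  carries the digits above position \<open>s\<close>, while \<open>q mod m ^ s\<close> carries those
  below, so only digit \<open>s\<close> remains free.\<close>

lemma eq_outside_digit_iff:
  assumes q: "q < m ^ n" "q' < m ^ n" and s: "s < n"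
  shows "q div m ^ s div m = q' div m ^ s div m \<and> q mod m ^ s = q' mod m ^ s \<longleftrightarrow>
    (\<forall>t<n. t \<noteq> s \<longrightarrow> digit m t q = digit m t q')"
proof -
  have high: "x div m ^ s div m = x div m ^ Suc s" for x
    unfolding power_Suc2 by (rule div_mult2_eq[symmetric])
  \<comment> \<open>This bounds the upper part by \<open>m ^ (n - Suc s)\<close>, so that its first
    \<open>n - Suc s\<close> digits determine it.\<close>
  have n: "m ^ n = m ^ (n - Suc s) * m ^ Suc s"
    using s unfolding power_add[symmetric] by simp
  have bound: "x div m ^ Suc s < m ^ (n - Suc s)" if "x < m ^ n" for x
    using that unfolding n by (rule less_mult_imp_div_less)
  have shift: "digit m t (x div m ^ Suc s) = digit m (Suc s + t) x" for t x
    unfolding digit_def power_add by (simp only: div_mult2_eq)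
  have "q div m ^ Suc s = q' div m ^ Suc s \<longleftrightarrow>
    (\<forall>t<n - Suc s. digit m (Suc s + t) q = digit m (Suc s + t) q')"
    using eq_iff_digits[OF q[THEN bound]] unfolding shift .
  also have "\<dots> \<longleftrightarrow> (\<forall>t<n. s < t \<longrightarrow> digit m t q = digit m t q')"
  proof (intro iffI allI impI)
    fix t assume "\<forall>t<n - Suc s. digit m (Suc s + t) q = digit m (Suc s + t) q'" "t < n" "s < t"
    then show "digit m t q = digit m t q'"
      by (auto dest!: spec[of _ "t - Suc s"])
  qed auto
  finally have upper: "q div m ^ Suc s = q' div m ^ Suc s \<longleftrightarrow>
    (\<forall>t<n. s < t \<longrightarrow> digit m t q = digit m t q')" .
  have "(\<forall>t<n. s < t \<longrightarrow> P t) \<and> (\<forall>t<s. P t) \<longleftrightarrow> (\<forall>t<n. t \<noteq> s \<longrightarrow> P t)" for P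
  proof (intro iffI conjI allI impI)
    fix t assume "(\<forall>t<n. s < t \<longrightarrow> P t) \<and> (\<forall>t<s. P t)" "t < n" "t \<noteq> s"
    then show "P t" by (cases "s < t") auto
  qed (use s in auto)
  then show ?thesis
    unfolding high mod_power_eq_iff_digits upper .
qed

section \<open>Entries of the matrix wreath product\<close>

lemma dim_kron [simp]:
  "dim_row (kron M N) = dim_row M * dim_row N"
  "dim_col (kron M N) = dim_col M * dim_col N"
  by (simp_all add: kron_def)

lemma index_kron:
  assumes "i < dim_row M * dim_row N" and "j < dim_col M * dim_col N"
  shows "kron M N $$ (i, j) =
    M $$ (i div dim_row N, j div dim_col N) * N $$ (i mod dim_row N, j mod dim_col N)"
  using assms by (simp add: kron_def)

lemma div_less_of_less_mult: "i div b < a" if "i < a * b" for a b i :: nat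
  using that by (simp add: less_mult_imp_div_less)

lemma mod_less_of_less_mult: "i mod b < b" if "i < a * b" for a b i :: nat
  using that by (cases "b = 0") auto

lemma kron_one_one: "kron (1\<^sub>m a) (1\<^sub>m b) = 1\<^sub>m (a * b)"
proof (rule eq_matI)
  fix i j assume ij: "i < dim_row (1\<^sub>m (a * b) :: complex mat)" "j < dim_col (1\<^sub>m (a * b) :: complex mat)"
  have "i = j \<longleftrightarrow> i div b = j div b \<and> i mod b = j mod b"
    by (metis div_mult_mod_eq)
  with ij show "kron (1\<^sub>m a) (1\<^sub>m b) $$ (i, j) = 1\<^sub>m (a * b) $$ (i, j)"
    by (auto simp: index_kron div_less_of_less_mult mod_less_of_less_mult)
qed simp_all

text \<open>The entries of this identity matrix compare whole blocks of \<open>r\<close> digits at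
  once.\<close>

lemma kron_power_one: "kron_power (1\<^sub>m m) r = 1\<^sub>m (m ^ r)"
  by (induction r) (simp_all add: kron_one_one)

text \<open>The product is bracketed to the left, so its indices are peeled off from the right: the
  diagonal unit matrix reads the residue modulo \<open>n\<close>, the right identity power the
  lowest \<open>n - 1 - i\<close> digits, \<open>B\<close> the next digit, and the left identity
  power the remaining \<open>i\<close> digits. The identities force their digits to agree. Hence
  \<open>B\<close> sits at position \<open>n - 1 - i\<close>, the number of identity factors to its
  right.\<close>

lemma index_wreath_summand:
  assumes B: "B \<in> carrier_mat m m" and i: "i < n"
    and j: "j < n * m ^ n" and k: "k < n * m ^ n"
  shows "kron (kron (kron (kron_power (1\<^sub>m m) i) B) (kron_power (1\<^sub>m m) (n - 1 - i)))
      (diag_unit_mat n i) $$ (j, k) =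
    (if j mod n = i \<and> k mod n = i \<and>
        (\<forall>t<n. t \<noteq> n - 1 - i \<longrightarrow> digit m t (j div n) = digit m t (k div n))
     then B $$ (digit m (n - 1 - i) (j div n), digit m (n - 1 - i) (k div n)) else 0)"
proof -
  define s where "s = n - 1 - i"
  have s: "s < n" "n = i + 1 + s" using i by (auto simp: s_def)
  have dims: "dim_row B = m" "dim_col B = m" using B by auto
  have dimD: "dim_row (diag_unit_mat n i) = n" "dim_col (diag_unit_mat n i) = n"
    by (simp_all add: diag_unit_mat_def)
  have mn: "m ^ n = m ^ i * m * m ^ s"
    by (subst s(2)) (simp add: power_add)
  \<comment> \<open>These are the range conditions of \<open>index_kron\<close> at each level of the
    nested product.\<close>
  have b0: "x < m ^ i * m * m ^ s * n" "x div n < m ^ i * m * m ^ s"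
    "x div n div m ^ s < m ^ i * m" "x div n div m ^ s div m < m ^ i"
    "x div n mod m ^ s < m ^ s" "x mod n < n" if "x < n * m ^ n" for x
  proof -
    show 0: "x < m ^ i * m * m ^ s * n"
      using that unfolding mn by (simp add: mult.commute)
    then show 1: "x div n < m ^ i * m * m ^ s" by (rule div_less_of_less_mult)
    then show 2: "x div n div m ^ s < m ^ i * m" by (rule div_less_of_less_mult)
    then show "x div n div m ^ s div m < m ^ i" by (rule div_less_of_less_mult)
    show "x div n mod m ^ s < m ^ s" using 1 by (rule mod_less_of_less_mult)
    show "x mod n < n" using 0 by (rule mod_less_of_less_mult)
  qed
  note b = b0[OF j] b0[OF k]
  have q: "j div n < m ^ n" "k div n < m ^ n" using b unfolding mn by blast+
  have "kron (kron (kron (1\<^sub>m (m ^ i)) B) (1\<^sub>m (m ^ s))) (diag_unit_mat n i) $$ (j, k) =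
    1\<^sub>m (m ^ i) $$ (j div n div m ^ s div m, k div n div m ^ s div m)
    * B $$ (digit m s (j div n), digit m s (k div n))
    * 1\<^sub>m (m ^ s) $$ (j div n mod m ^ s, k div n mod m ^ s)
    * diag_unit_mat n i $$ (j mod n, k mod n)"
    using b by (simp add: index_kron dims dimD digit_def)
  also have "\<dots> = (if j mod n = i \<and> k mod n = i \<and>
      (j div n div m ^ s div m = k div n div m ^ s div m \<and> j div n mod m ^ s = k div n mod m ^ s)
     then B $$ (digit m s (j div n), digit m s (k div n)) else 0)"
    using b by (simp add: diag_unit_mat_def)
  finally show ?thesis
    unfolding eq_outside_digit_iff[OF q s(1)] unfolding kron_power_one s_def .
qed

lemma dim_wreath_mat:
  "dim_row (wreath_mat A B) = dim_row A * dim_row B ^ dim_row A"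
  "dim_col (wreath_mat A B) = dim_row A * dim_row B ^ dim_row A"
  by (simp_all add: wreath_mat_def Let_def)

text \<open>The diagonal unit matrices leave at most one term of the sum alive, the one with
  \<open>i = j mod n\<close>; this is why \<open>s\<close> depends on \<open>j\<close>
  alone.\<close>

lemma index_wreath_mat:
  assumes A: "A \<in> carrier_mat n n" and B: "B \<in> carrier_mat m m"
    and j: "j < n * m ^ n" and k: "k < n * m ^ n"
  defines "s \<equiv> n - 1 - j mod n"
  shows "wreath_mat A B $$ (j, k) =
    (if \<forall>t<n. digit m t (j div n) = digit m t (k div n) then A $$ (j mod n, k mod n) else 0) +
    (if j mod n = k mod n \<and> (\<forall>t<n. t \<noteq> s \<longrightarrow> digit m t (j div n) = digit m t (k div n))
     then B $$ (digit m s (j div n), digit m s (k div n)) else 0)"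
proof -
  have dims: "dim_row A = n" "dim_col A = n" "dim_row B = m" "dim_col B = m" using A B by auto
  have jk: "j < m ^ n * n" "k < m ^ n * n" using j k by (simp_all add: mult.commute)
  then have q: "j div n < m ^ n" "k div n < m ^ n" and n: "j mod n < n"
    by (auto simp: div_less_of_less_mult intro: mod_less_of_less_mult)
  let ?E = "\<lambda>i. \<forall>t<n. t \<noteq> n - 1 - i \<longrightarrow> digit m t (j div n) = digit m t (k div n)"
  let ?B = "\<lambda>i. B $$ (digit m (n - 1 - i) (j div n), digit m (n - 1 - i) (k div n))"
  have "(\<Sum>i<n. kron (kron (kron (kron_power (1\<^sub>m m) i) B) (kron_power (1\<^sub>m m) (n - 1 - i)))
      (diag_unit_mat n i) $$ (j, k)) = (\<Sum>i<n. if j mod n = i \<and> k mod n = i \<and> ?E i then ?B i else 0)"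
    by (intro sum.cong refl index_wreath_summand[OF B _ j k]) simp
  \<comment> \<open>Isolating the test \<open>j mod n = i\<close> brings the sum into the shape of
    \<open>sum.delta'\<close>.\<close>
  also have "\<dots> = (\<Sum>i<n. if j mod n = i then (if k mod n = i \<and> ?E i then ?B i else 0) else 0)"
    by (rule sum.cong) auto
  also have "\<dots> = (if k mod n = j mod n \<and> ?E (j mod n) then ?B (j mod n) else 0)"
    using n by (subst sum.delta') auto
  finally have sum: "(\<Sum>i<n. kron (kron (kron (kron_power (1\<^sub>m m) i) B)
      (kron_power (1\<^sub>m m) (n - 1 - i))) (diag_unit_mat n i) $$ (j, k)) =
    (if k mod n = j mod n \<and> ?E (j mod n) then ?B (j mod n) else 0)" .
  have "kron (kron_power (1\<^sub>m m) n) A $$ (j, k) =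
    (if \<forall>t<n. digit m t (j div n) = digit m t (k div n) then A $$ (j mod n, k mod n) else 0)"
    unfolding eq_iff_digits[OF q, symmetric]
    using q jk by (simp add: kron_power_one index_kron dims)
  moreover have "wreath_mat A B $$ (j, k) = kron (kron_power (1\<^sub>m m) n) A $$ (j, k) +
    (\<Sum>i<n. kron (kron (kron (kron_power (1\<^sub>m m) i) B)
      (kron_power (1\<^sub>m m) (n - 1 - i))) (diag_unit_mat n i) $$ (j, k))"
    using j k by (simp add: wreath_mat_def Let_def dims)
  ultimately show ?thesis
    unfolding sum s_def eq_commute[of "k mod n" "j mod n"] by (simp only:)
qed

section \<open>The graph wreath product\<close>

lemma verts_wreath: "verts (wreath_graph G1 G2) = (verts G1 \<rightarrow>\<^sub>E verts G2) \<times> verts G1"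
  by (simp add: wreath_graph_def)

lemma ends_wreath: "ends (wreath_graph G1 G2) = fst"
  by (simp add: wreath_graph_def)

lemma Inl_edge_wreath_iff:
  "(P, Inl e) \<in> edges (wreath_graph G1 G2) \<longleftrightarrow>
    (\<exists>f f' v. P = {(f, v), (f', v)} \<and> f \<in> verts G1 \<rightarrow>\<^sub>E verts G2 \<and> f' \<in> verts G1 \<rightarrow>\<^sub>E verts G2 \<and>
      v \<in> verts G1 \<and> (\<forall>w\<in>verts G1. w \<noteq> v \<longrightarrow> f w = f' w) \<and> e \<in> edges G2 \<and> ends G2 e = {f v, f' v})"
  by (simp add: wreath_graph_def)

lemma Inr_edge_wreath_iff:
  "(P, Inr e) \<in> edges (wreath_graph G1 G2) \<longleftrightarrow>
    (\<exists>f v v'. P = {(f, v), (f, v')} \<and> f \<in> verts G1 \<rightarrow>\<^sub>E verts G2 \<and> v \<in> verts G1 \<and> v' \<in> verts G1 \<and>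
      e \<in> edges G1 \<and> ends G1 e = {v, v'})"
  by (simp add: wreath_graph_def)

text \<open>The endpoint set is unordered, so \<open>(f, v)\<close> may be either of the two
  vertices named in the definition. The adjacency rule is symmetric, which allows the given endpoint
  to be put first.\<close>

lemma Inl_edge_wreath_at:
  assumes "(P, Inl e) \<in> edges (wreath_graph G1 G2)" and "(f, v) \<in> P"
  obtains g where "P = {(f, v), (g, v)}" "f \<in> verts G1 \<rightarrow>\<^sub>E verts G2" "g \<in> verts G1 \<rightarrow>\<^sub>E verts G2"
    "v \<in> verts G1" "\<And>w. w \<in> verts G1 \<Longrightarrow> w \<noteq> v \<Longrightarrow> f w = g w" "e \<in> edges G2" "ends G2 e = {f v, g v}"
proof -
  obtain h h' u where P: "P = {(h, u), (h', u)}" "h \<in> verts G1 \<rightarrow>\<^sub>E verts G2"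
    "h' \<in> verts G1 \<rightarrow>\<^sub>E verts G2" "u \<in> verts G1" "\<forall>w\<in>verts G1. w \<noteq> u \<longrightarrow> h w = h' w"
    "e \<in> edges G2" "ends G2 e = {h u, h' u}"
    using assms(1) unfolding Inl_edge_wreath_iff by (elim exE conjE) (rule that)
  from assms(2) P(1) consider "f = h" "v = u" | "f = h'" "v = u" by auto
  then show thesis
  proof cases
    case 1
    show ?thesis unfolding 1
      by (rule that[of h', unfolded 1]) (use P in \<open>simp_all add: insert_commute\<close>)
  next
    case 2
    show ?thesis unfolding 2
      by (rule that[of h, unfolded 2]) (use P in \<open>simp_all add: insert_commute\<close>)
  qed
qed

lemma Inr_edge_wreath_at:
  assumes "(P, Inr e) \<in> edges (wreath_graph G1 G2)" and "(f, v) \<in> P"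
  obtains v' where "P = {(f, v), (f, v')}" "f \<in> verts G1 \<rightarrow>\<^sub>E verts G2"
    "v \<in> verts G1" "v' \<in> verts G1" "e \<in> edges G1" "ends G1 e = {v, v'}"
proof -
  obtain h u u' where P: "P = {(h, u), (h, u')}" "h \<in> verts G1 \<rightarrow>\<^sub>E verts G2"
    "u \<in> verts G1" "u' \<in> verts G1" "e \<in> edges G1" "ends G1 e = {u, u'}"
    using assms(1) unfolding Inr_edge_wreath_iff by (elim exE conjE) (rule that)
  from assms(2) P(1) consider "f = h" "v = u" | "f = h" "v = u'" by auto
  then show thesis
  proof cases
    case 1
    show ?thesis unfolding 1
      by (rule that[of u', unfolded 1]) (use P in \<open>simp_all add: insert_commute\<close>)
  next
    case 2
    show ?thesis unfolding 2
      by (rule that[of u, unfolded 2]) (use P in \<open>simp_all add: insert_commute\<close>)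
  qed
qed

section \<open>Finiteness, edge multiplicities and regularity of the graph wreath product\<close>

lemma finite_multigraph_wreath:
  assumes "finite_multigraph G1" and "finite_multigraph G2"
  shows "finite_multigraph (wreath_graph G1 G2)"
proof -
  let ?W = "wreath_graph G1 G2"
  have fin: "finite (verts G1)" "finite (edges G1)" "finite (verts G2)" "finite (edges G2)"
    using assms by (auto simp: finite_multigraph_def)
  then have finV: "finite (verts ?W)" by (auto simp: verts_wreath intro: finite_PiE)
  have "edges ?W \<subseteq> Pow (verts ?W) \<times> (edges G2 <+> edges G1)"
    by (auto simp: wreath_graph_def)
  then have "finite (edges ?W)"
    using finV fin by (auto intro: finite_subset)
  moreover have "\<exists>u\<in>verts ?W. \<exists>v\<in>verts ?W. ends ?W e = {u, v}" if "e \<in> edges ?W" for e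
  proof -
    obtain P x where e: "e = (P, x)" by (cases e)
    show ?thesis
    proof (cases x)
      case (Inl y)
      from that[unfolded e Inl] obtain f f' v where "P = {(f, v), (f', v)}" "f \<in> verts G1 \<rightarrow>\<^sub>E verts G2"
        "f' \<in> verts G1 \<rightarrow>\<^sub>E verts G2" "v \<in> verts G1"
        unfolding Inl_edge_wreath_iff by blast
      with e show ?thesis
        by (intro bexI[of _ "(f, v)"] bexI[of _ "(f', v)"]) (simp_all add: verts_wreath ends_wreath)
    next
      case (Inr y)
      from that[unfolded e Inr] obtain f v v' where "P = {(f, v), (f, v')}" "f \<in> verts G1 \<rightarrow>\<^sub>E verts G2"
        "v \<in> verts G1" "v' \<in> verts G1"
        unfolding Inr_edge_wreath_iff by blast
      with e show ?thesis
        by (intro bexI[of _ "(f, v)"] bexI[of _ "(f, v')"]) (simp_all add: verts_wreath ends_wreath)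
    qed
  qed
  ultimately show ?thesis using finV by (simp add: finite_multigraph_def)
qed

text \<open>Once the endpoint set is fixed, an edge is determined by its label, so
  \<open>snd\<close> maps these edges bijectively onto a disjoint union of edges of the two factors.
  Loops at one vertex can satisfy both rules, and then the two counts add.\<close>

lemma edge_mult_wreath:
  assumes fin: "finite (edges G1)" "finite (edges G2)"
    and V: "(f, v) \<in> verts (wreath_graph G1 G2)" "(f', v') \<in> verts (wreath_graph G1 G2)"
  shows "edge_mult (wreath_graph G1 G2) (f, v) (f', v') =
    (if f = f' then edge_mult G1 v v' else 0) +
    (if v = v' \<and> (\<forall>w\<in>verts G1. w \<noteq> v \<longrightarrow> f w = f' w) then edge_mult G2 (f v) (f' v) else 0)"
proof -
  let ?W = "wreath_graph G1 G2"
  let ?S = "{e \<in> edges ?W. ends ?W e = {(f, v), (f', v')}}"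
  let ?S2 = "if v = v' \<and> (\<forall>w\<in>verts G1. w \<noteq> v \<longrightarrow> f w = f' w)
    then {e \<in> edges G2. ends G2 e = {f v, f' v}} else {}"
  let ?S1 = "if f = f' then {e \<in> edges G1. ends G1 e = {v, v'}} else {}"
  have inj: "inj_on snd ?S" by (auto simp: inj_on_def ends_wreath)
  have "snd ` ?S = ?S2 <+> ?S1"
  proof (intro Set.set_eqI iffI)
    fix x assume "x \<in> snd ` ?S"
    then have x: "({(f, v), (f', v')}, x) \<in> edges ?W" by (auto simp: ends_wreath)
    show "x \<in> ?S2 <+> ?S1"
    proof (cases x)
      case (Inl e)
      \<comment> \<open>With \<open>(f, v)\<close> placed first, equality of the two doubletons
        forces the other endpoints to coincide.\<close>
      with x show ?thesis
        by (auto elim!: Inl_edge_wreath_at[where f = f and v = v] simp: doubleton_eq_iff)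
    next
      case (Inr e)
      with x show ?thesis
        by (auto elim!: Inr_edge_wreath_at[where f = f and v = v] simp: doubleton_eq_iff)
    qed
  next
    fix x assume "x \<in> ?S2 <+> ?S1"
    then have "({(f, v), (f', v')}, x) \<in> edges ?W"
    proof (elim PlusE)
      fix e assume "e \<in> ?S2" "x = Inl e"
      then show ?thesis using V
        by (auto simp: Inl_edge_wreath_iff verts_wreath split: if_splits)
    next
      fix e assume "e \<in> ?S1" "x = Inr e"
      then show ?thesis using V
        by (auto simp: Inr_edge_wreath_iff verts_wreath split: if_splits)
    qed
    then show "x \<in> snd ` ?S" by (force simp: ends_wreath)
  qed
  then have "card ?S = card (?S2 <+> ?S1)" using card_image[OF inj] by simp
  also have "\<dots> = card ?S2 + card ?S1" using fin by (intro card_Plus) auto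
  finally show ?thesis
    unfolding edge_mult_def by (simp only: if_distrib[of card] card.empty add.commute)
qed

text \<open>At a fixed vertex \<open>(f, v)\<close> the label alone determines the edge: an edge of
  \<open>G2\<close> at \<open>f v\<close> fixes the new value at \<open>v\<close>, and an edge of
  \<open>G1\<close> at \<open>v\<close> fixes the vertex moved to. So the incident edges are counted
  by the disjoint union of the edges of \<open>G2\<close> at \<open>f v\<close> and those of
  \<open>G1\<close> at \<open>v\<close>, loops counting once throughout.\<close>

lemma regular_wreath:
  assumes G1: "finite_multigraph G1" "regular G1 d1" and G2: "finite_multigraph G2" "regular G2 d2"
  shows "regular (wreath_graph G1 G2) (d1 + d2)"
  unfolding regular_def
proof
  let ?W = "wreath_graph G1 G2"
  fix x assume "x \<in> verts ?W"
  then obtain f v where x: "x = (f, v)" and f: "f \<in> verts G1 \<rightarrow>\<^sub>E verts G2" and v: "v \<in> verts G1"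
    by (auto simp: verts_wreath)
  let ?S = "{e \<in> edges ?W. x \<in> ends ?W e}"
  let ?S2 = "{e \<in> edges G2. f v \<in> ends G2 e}"
  let ?S1 = "{e \<in> edges G1. v \<in> ends G1 e}"
  have inj: "inj_on snd ?S"
  proof (rule inj_onI, clarsimp simp: ends_wreath x)
    fix P Q y assume P: "(P, y) \<in> edges ?W" "(f, v) \<in> P" and Q: "(Q, y) \<in> edges ?W" "(f, v) \<in> Q"
    show "P = Q"
    proof (cases y)
      case (Inl e)
      obtain g where g: "P = {(f, v), (g, v)}" "g \<in> verts G1 \<rightarrow>\<^sub>E verts G2"
        "\<And>w. w \<in> verts G1 \<Longrightarrow> w \<noteq> v \<Longrightarrow> f w = g w" "ends G2 e = {f v, g v}"
        using Inl_edge_wreath_at P Inl by metis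
      obtain h where h: "Q = {(f, v), (h, v)}" "h \<in> verts G1 \<rightarrow>\<^sub>E verts G2"
        "\<And>w. w \<in> verts G1 \<Longrightarrow> w \<noteq> v \<Longrightarrow> f w = h w" "ends G2 e = {f v, h v}"
        using Inl_edge_wreath_at Q Inl by metis
      \<comment> \<open>Both values are the end of \<open>e\<close> opposite to \<open>f v\<close>.
        Away from \<open>v\<close> both functions agree with \<open>f\<close>, and extensionality
        then gives \<open>g = h\<close>.\<close>
      have "g v = h v" using g(4) h(4) by (auto simp: doubleton_eq_iff)
      then have "g w = h w" if "w \<in> verts G1" for w
        using that g(3)[of w] h(3)[of w] by (cases "w = v") simp_all
      then have "g = h" by (rule PiE_ext[OF g(2) h(2)])
      with g h show ?thesis by simp
    next
      case (Inr e)
      obtain u where u: "P = {(f, v), (f, u)}" "ends G1 e = {v, u}"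
        using Inr_edge_wreath_at P Inr by metis
      obtain w where w: "Q = {(f, v), (f, w)}" "ends G1 e = {v, w}"
        using Inr_edge_wreath_at Q Inr by metis
      have "u = w" using u(2) w(2) by (auto simp: doubleton_eq_iff)
      with u w show ?thesis by simp
    qed
  qed
  have "snd ` ?S = ?S2 <+> ?S1"
  proof (intro Set.set_eqI iffI)
    fix y assume "y \<in> snd ` ?S"
    then obtain P where P: "(P, y) \<in> edges ?W" "(f, v) \<in> P" by (auto simp: ends_wreath x)
    show "y \<in> ?S2 <+> ?S1"
    proof (cases y)
      case (Inl e)
      with P show ?thesis by (auto elim!: Inl_edge_wreath_at)
    next
      case (Inr e)
      with P show ?thesis by (auto elim!: Inr_edge_wreath_at)
    qed
  next
    fix y assume "y \<in> ?S2 <+> ?S1"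
    then have "\<exists>P. (P, y) \<in> edges ?W \<and> (f, v) \<in> P"
    proof (elim PlusE)
      fix e assume e: "e \<in> ?S2" "y = Inl e"
      \<comment> \<open>The other end \<open>b\<close> of \<open>e\<close> gives the neighbour
        \<open>f(v := b)\<close>; if \<open>e\<close> is a loop, then \<open>b = f v\<close> and the
        neighbour is \<open>(f, v)\<close> itself.\<close>
      then obtain b where b: "b \<in> verts G2" "ends G2 e = {f v, b}"
        using G2(1) unfolding finite_multigraph_def by fastforce
      have "f(v := b) \<in> verts G1 \<rightarrow>\<^sub>E verts G2"
        using f v b by (auto simp: PiE_iff extensional_def)
      then have "({(f, v), (f(v := b), v)}, y) \<in> edges ?W"
        unfolding e(2) Inl_edge_wreath_iff using e f v b
        by (intro exI[of _ f] exI[of _ "f(v := b)"] exI[of _ v]) auto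
      then show ?thesis by blast
    next
      fix e assume e: "e \<in> ?S1" "y = Inr e"
      then obtain u where u: "u \<in> verts G1" "ends G1 e = {v, u}"
        using G1(1) unfolding finite_multigraph_def by fastforce
      then have "({(f, v), (f, u)}, y) \<in> edges ?W"
        unfolding e(2) Inr_edge_wreath_iff using e f v by blast
      then show ?thesis by blast
    qed
    then show "y \<in> snd ` ?S" by (force simp: ends_wreath x)
  qed
  then have "card ?S = card (?S2 <+> ?S1)" using card_image[OF inj] by simp
  also have "\<dots> = card ?S2 + card ?S1"
    using G1(1) G2(1) by (intro card_Plus) (auto simp: finite_multigraph_def)
  also have "card ?S2 = d2" using G2(2) f v by (auto simp: regular_def)
  also have "card ?S1 = d1" using G1(2) v by (auto simp: regular_def)
  finally show "card ?S = d1 + d2" by simp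
qed

section \<open>The ordering of the vertices\<close>

text \<open>The position of \<open>v\<close> in \<open>vs1\<close> is reversed because the leftmost
  Kronecker factor governs the most significant digit. Restriction to \<open>set vs1\<close> makes
  the result extensional, as membership in \<open>PiE\<close> demands.\<close>

definition decode :: "'a list \<Rightarrow> 'b list \<Rightarrow> nat \<Rightarrow> 'a \<Rightarrow> 'b" where
  "decode vs1 vs2 q = (\<lambda>v\<in>set vs1. vs2 ! digit (length vs2)
     (length vs1 - 1 - the_inv_into {..<length vs1} ((!) vs1) v) q)"

text \<open>The vertex of the first graph comes from the residue because the matrices of order
  \<open>n\<close> (\<open>A\<close> and the diagonal units) are the rightmost Kronecker
  factors.\<close>

definition wreath_verts :: "'a list \<Rightarrow> 'b list \<Rightarrow> (('a \<Rightarrow> 'b) \<times> 'a) list" where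
  "wreath_verts vs1 vs2 =
     map (\<lambda>k. (decode vs1 vs2 (k div length vs1), vs1 ! (k mod length vs1)))
       [0..<length vs1 * length vs2 ^ length vs1]"

lemma decode_nth:
  assumes "distinct vs1" and "i < length vs1"
  shows "decode vs1 vs2 q (vs1 ! i) = vs2 ! digit (length vs2) (length vs1 - 1 - i) q"
  using assms by (simp add: decode_def the_inv_into_f_f inj_on_nth)

lemma digit_less:
  assumes "q < m ^ n" and "t < n"
  shows "digit m t q < m"
  \<comment> \<open>For \<open>m = 0\<close>, \<open>t < n\<close> gives \<open>0 ^ n = 0\<close>,
    which contradicts the bound on \<open>q\<close>.\<close>
  using assms by (cases "m = 0") (auto simp: digit_def power_0_left)

lemma decode_PiE:
  assumes d: "distinct vs1" and q: "q < length vs2 ^ length vs1"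
  shows "decode vs1 vs2 q \<in> set vs1 \<rightarrow>\<^sub>E set vs2"
proof (rule PiE_I)
  fix v assume "v \<in> set vs1"
  then obtain i where i: "i < length vs1" "v = vs1 ! i" by (auto simp: in_set_conv_nth)
  then show "decode vs1 vs2 q v \<in> set vs2"
    using digit_less[OF q, of "length vs1 - 1 - i"] by (simp add: decode_nth[OF d])
qed (simp add: decode_def)

lemma decode_nth_eq_iff:
  assumes d: "distinct vs1" "distinct vs2"
    and q: "q < length vs2 ^ length vs1" "q' < length vs2 ^ length vs1" and i: "i < length vs1"
  shows "decode vs1 vs2 q (vs1 ! i) = decode vs1 vs2 q' (vs1 ! i) \<longleftrightarrow>
    digit (length vs2) (length vs1 - 1 - i) q = digit (length vs2) (length vs1 - 1 - i) q'"
  using i by (simp add: decode_nth[OF d(1)] nth_eq_iff_index_eq[OF d(2)] digit_less[OF q(1)] digit_less[OF q(2)])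

text \<open>Translates between vertex numbers and digit positions, which run in opposite
  directions.\<close>

lemma all_less_reverse: "(\<forall>i<n. P (n - 1 - i)) \<longleftrightarrow> (\<forall>t<n. P t)" for n :: nat
proof (intro iffI allI impI)
  fix t assume "\<forall>i<n. P (n - 1 - i)" "t < n"
  then show "P t" by (auto dest!: spec[of _ "n - 1 - t"])
qed auto

lemma decode_eq_outside_iff:
  assumes d: "distinct vs1" "distinct vs2"
    and q: "q < length vs2 ^ length vs1" "q' < length vs2 ^ length vs1" and i: "i < length vs1"
  shows "(\<forall>w\<in>set vs1. w \<noteq> vs1 ! i \<longrightarrow> decode vs1 vs2 q w = decode vs1 vs2 q' w) \<longleftrightarrow>
    (\<forall>t<length vs1. t \<noteq> length vs1 - 1 - i \<longrightarrow> digit (length vs2) t q = digit (length vs2) t q')"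
proof -
  let ?n = "length vs1"
  have "(\<forall>w\<in>set vs1. w \<noteq> vs1 ! i \<longrightarrow> decode vs1 vs2 q w = decode vs1 vs2 q' w) \<longleftrightarrow>
    (\<forall>l<?n. ?n - 1 - l \<noteq> ?n - 1 - i \<longrightarrow>
      digit (length vs2) (?n - 1 - l) q = digit (length vs2) (?n - 1 - l) q')"
    unfolding all_set_conv_all_nth using i
    by (intro all_cong) (auto simp: decode_nth_eq_iff[OF d q] nth_eq_iff_index_eq[OF d(1)])
  then show ?thesis
    using all_less_reverse[of ?n "\<lambda>t. t \<noteq> ?n - 1 - i \<longrightarrow> digit (length vs2) t q = digit (length vs2) t q'"]
    by simp
qed

lemma decode_eq_iff:
  assumes d: "distinct vs1" "distinct vs2"
    and q: "q < length vs2 ^ length vs1" "q' < length vs2 ^ length vs1"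
  shows "decode vs1 vs2 q = decode vs1 vs2 q' \<longleftrightarrow>
    (\<forall>t<length vs1. digit (length vs2) t q = digit (length vs2) t q')"
proof -
  have "decode vs1 vs2 q = decode vs1 vs2 q' \<longleftrightarrow>
    (\<forall>w\<in>set vs1. decode vs1 vs2 q w = decode vs1 vs2 q' w)"
    using PiE_ext[OF decode_PiE[OF d(1) q(1)] decode_PiE[OF d(1) q(2)]] by auto
  also have "\<dots> \<longleftrightarrow> (\<forall>l<length vs1. digit (length vs2) (length vs1 - 1 - l) q =
      digit (length vs2) (length vs1 - 1 - l) q')"
    unfolding all_set_conv_all_nth by (intro all_cong) (simp add: decode_nth_eq_iff[OF d q])
  finally show ?thesis
    using all_less_reverse[of "length vs1" "\<lambda>t. digit (length vs2) t q = digit (length vs2) t q'"]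
    by simp
qed

lemma length_wreath_verts:
  "length (wreath_verts vs1 vs2) = length vs1 * length vs2 ^ length vs1"
  by (simp add: wreath_verts_def)

lemma nth_wreath_verts:
  assumes "k < length vs1 * length vs2 ^ length vs1"
  shows "wreath_verts vs1 vs2 ! k =
    (decode vs1 vs2 (k div length vs1), vs1 ! (k mod length vs1))"
  using assms by (simp add: wreath_verts_def)

lemma distinct_wreath_verts:
  assumes d: "distinct vs1" "distinct vs2"
  shows "distinct (wreath_verts vs1 vs2)"
  unfolding wreath_verts_def distinct_map
proof (intro conjI inj_onI)
  let ?n = "length vs1" and ?m = "length vs2"
  fix j k assume "j \<in> set [0..<?n * ?m ^ ?n]" "k \<in> set [0..<?n * ?m ^ ?n]"
    and eq: "(decode vs1 vs2 (j div ?n), vs1 ! (j mod ?n)) =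
      (decode vs1 vs2 (k div ?n), vs1 ! (k mod ?n))"
  then have jk: "j < ?m ^ ?n * ?n" "k < ?m ^ ?n * ?n" by (simp_all add: mult.commute)
  note q = jk[THEN div_less_of_less_mult]
  have "j div ?n = k div ?n"
    using eq decode_eq_iff[OF d q] eq_iff_digits[OF q] by simp
  moreover have "j mod ?n = k mod ?n"
    using eq nth_eq_iff_index_eq[OF d(1) jk[THEN mod_less_of_less_mult]] by simp
  ultimately show "j = k" by (metis div_mult_mod_eq)
qed simp

text \<open>Surjectivity by counting: the list is distinct, lies in the vertex set, and its length
  equals the cardinality of that set. No inverse of \<open>decode\<close> has to be built.\<close>

lemma set_wreath_verts:
  assumes d: "distinct vs1" "distinct vs2"
  shows "set (wreath_verts vs1 vs2) = (set vs1 \<rightarrow>\<^sub>E set vs2) \<times> set vs1"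
proof (rule card_subset_eq)
  let ?n = "length vs1" and ?m = "length vs2"
  show "finite ((set vs1 \<rightarrow>\<^sub>E set vs2) \<times> set vs1)" by (auto intro: finite_PiE)
  show "set (wreath_verts vs1 vs2) \<subseteq> (set vs1 \<rightarrow>\<^sub>E set vs2) \<times> set vs1"
  proof
    fix x assume "x \<in> set (wreath_verts vs1 vs2)"
    then obtain k where k: "k < ?m ^ ?n * ?n"
      and x: "x = (decode vs1 vs2 (k div ?n), vs1 ! (k mod ?n))"
      by (auto simp: wreath_verts_def mult.commute)
    show "x \<in> (set vs1 \<rightarrow>\<^sub>E set vs2) \<times> set vs1"
      unfolding x using decode_PiE[OF d(1) div_less_of_less_mult[OF k]] mod_less_of_less_mult[OF k]
      by simp
  qed
  show "card (set (wreath_verts vs1 vs2)) = card ((set vs1 \<rightarrow>\<^sub>E set vs2) \<times> set vs1)"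
    using d by (simp add: distinct_card distinct_wreath_verts length_wreath_verts
        card_cartesian_product card_PiE)
qed

section \<open>Comparison of the two matrices entry by entry\<close>

lemma wreath_mat_norm_adj:
  assumes fin: "finite (edges G1)" "finite (edges G2)" and pos: "d1 \<ge> 1" "d2 \<ge> 1"
    and vs1: "distinct vs1" "set vs1 = verts G1" and vs2: "distinct vs2" "set vs2 = verts G2"
  shows "wreath_mat ((of_nat d1 / of_nat (d1 + d2)) \<cdot>\<^sub>m norm_adj_mat G1 d1 vs1)
      ((of_nat d2 / of_nat (d1 + d2)) \<cdot>\<^sub>m norm_adj_mat G2 d2 vs2) =
    norm_adj_mat (wreath_graph G1 G2) (d1 + d2) (wreath_verts vs1 vs2)"
    (is "wreath_mat ?A ?B = ?C")
proof (rule eq_matI)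
  let ?n = "length vs1" and ?m = "length vs2" and ?W = "wreath_graph G1 G2"
  have A: "?A \<in> carrier_mat ?n ?n" and B: "?B \<in> carrier_mat ?m ?m"
    by (auto simp: norm_adj_mat_def)
  show dims: "dim_row (wreath_mat ?A ?B) = dim_row ?C" "dim_col (wreath_mat ?A ?B) = dim_col ?C"
    by (simp_all add: dim_wreath_mat norm_adj_mat_def length_wreath_verts)
  fix j k assume "j < dim_row ?C" "k < dim_col ?C"
  then have j: "j < ?n * ?m ^ ?n" and k: "k < ?n * ?m ^ ?n"
    by (simp_all add: norm_adj_mat_def length_wreath_verts)
  then have jk: "j < ?m ^ ?n * ?n" "k < ?m ^ ?n * ?n" by (simp_all add: mult.commute)
  note q = jk[THEN div_less_of_less_mult] and r = jk[THEN mod_less_of_less_mult]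
  let ?f = "decode vs1 vs2 (j div ?n)" and ?g = "decode vs1 vs2 (k div ?n)"
  let ?v = "vs1 ! (j mod ?n)" and ?w = "vs1 ! (k mod ?n)"
  define s where "s = ?n - 1 - j mod ?n"
  have s: "s < ?n" using r(1) by (auto simp: s_def)
  \<comment> \<open>The scalar's numerator \<open>d1\<close> cancels the normalization of the
    factor, which uses \<open>d1 \<ge> 1\<close> and leaves the common denominator
    \<open>d1 + d2\<close>. The same happens for \<open>d2\<close> below.\<close>
  have scaled_A: "?A $$ (j mod ?n, k mod ?n) = of_nat (edge_mult G1 ?v ?w) / of_nat (d1 + d2)"
    using r pos by (simp add: norm_adj_mat_def)
  \<comment> \<open>Digit \<open>s\<close> is where \<open>decode\<close> stores the value at vertex
    number \<open>j mod ?n\<close>, so the entry of \<open>B\<close> compares the two functions at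
    the current vertex.\<close>
  have scaled_B: "?B $$ (digit ?m s (j div ?n), digit ?m s (k div ?n)) =
    of_nat (edge_mult G2 (?f ?v) (?g ?v)) / of_nat (d1 + d2)"
    using digit_less[OF q(1) s] digit_less[OF q(2) s] pos
    by (simp add: norm_adj_mat_def decode_nth[OF vs1(1) r(1)] s_def)
  have mult: "edge_mult ?W (?f, ?v) (?g, ?w) =
    (if ?f = ?g then edge_mult G1 ?v ?w else 0) +
    (if ?v = ?w \<and> (\<forall>u\<in>set vs1. u \<noteq> ?v \<longrightarrow> ?f u = ?g u) then edge_mult G2 (?f ?v) (?g ?v) else 0)"
    unfolding vs1(2)
    by (rule edge_mult_wreath[OF fin])
      (use decode_PiE[OF vs1(1) q(1)] decode_PiE[OF vs1(1) q(2)] r nth_mem[OF r(1)] nth_mem[OF r(2)]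
        in \<open>simp_all add: verts_wreath vs1 vs2\<close>)
  have if_divide: "of_nat (if b then x else 0) / c = (if b then of_nat x / c else 0)"
    for b x and c :: complex by simp
  have "?C $$ (j, k) = of_nat (edge_mult ?W (?f, ?v) (?g, ?w)) / of_nat (d1 + d2)"
    using j k by (simp add: norm_adj_mat_def length_wreath_verts nth_wreath_verts)
  also have "\<dots> =
    (if ?f = ?g then of_nat (edge_mult G1 ?v ?w) / of_nat (d1 + d2) else 0) +
    (if ?v = ?w \<and> (\<forall>u\<in>set vs1. u \<noteq> ?v \<longrightarrow> ?f u = ?g u)
     then of_nat (edge_mult G2 (?f ?v) (?g ?v)) / of_nat (d1 + d2) else 0)"
    unfolding mult of_nat_add add_divide_distrib if_divide ..
  also have "\<dots> = wreath_mat ?A ?B $$ (j, k)"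
    unfolding index_wreath_mat[OF A B j k] s_def[symmetric] scaled_A scaled_B
      decode_eq_iff[OF vs1(1) vs2(1) q] decode_eq_outside_iff[OF vs1(1) vs2(1) q r(1)]
      nth_eq_iff_index_eq[OF vs1(1) r] ..
  finally show "wreath_mat ?A ?B $$ (j, k) = ?C $$ (j, k)" ..
qed

theorem theorem3p2:
  fixes G1 :: "('a, 'e) multigraph" and G2 :: "('b, 'f) multigraph"
    and d1 d2 n1 n2 :: nat and vs1 :: "'a list" and vs2 :: "'b list"
    and A1 A2 :: "complex mat"
  assumes "finite_multigraph G1" and "regular G1 d1" and "d1 \<ge> 1"
    and "finite_multigraph G2" and "regular G2 d2" and "d2 \<ge> 1"
    and "distinct vs1" and "set vs1 = verts G1" and "A1 = norm_adj_mat G1 d1 vs1"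
    and "distinct vs2" and "set vs2 = verts G2" and "A2 = norm_adj_mat G2 d2 vs2"
    and "n1 = card (verts G1)" and "n2 = card (verts G2)"
  shows "finite_multigraph (wreath_graph G1 G2) \<and>
    regular (wreath_graph G1 G2) (d1 + d2) \<and>
    (\<exists>ws. distinct ws \<and> set ws = verts (wreath_graph G1 G2) \<and> length ws = n1 * n2 ^ n1 \<and>
       wreath_mat ((of_nat d1 / of_nat (d1 + d2)) \<cdot>\<^sub>m A1) ((of_nat d2 / of_nat (d1 + d2)) \<cdot>\<^sub>m A2)
         = norm_adj_mat (wreath_graph G1 G2) (d1 + d2) ws)"
proof (intro conjI exI[of _ "wreath_verts vs1 vs2"])
  show "finite_multigraph (wreath_graph G1 G2)"
    using assms(1,4) by (rule finite_multigraph_wreath)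
  show "regular (wreath_graph G1 G2) (d1 + d2)"
    using assms(1,2,4,5) by (rule regular_wreath)
  show "distinct (wreath_verts vs1 vs2)"
    using assms(7,10) by (rule distinct_wreath_verts)
  show "set (wreath_verts vs1 vs2) = verts (wreath_graph G1 G2)"
    using set_wreath_verts[OF assms(7,10)] by (simp add: verts_wreath assms(8,11))
  show "length (wreath_verts vs1 vs2) = n1 * n2 ^ n1"
    using distinct_card[OF assms(7)] distinct_card[OF assms(10)] assms(8,11,13,14)
    by (simp add: length_wreath_verts)
  show "wreath_mat ((of_nat d1 / of_nat (d1 + d2)) \<cdot>\<^sub>m A1) ((of_nat d2 / of_nat (d1 + d2)) \<cdot>\<^sub>m A2)
      = norm_adj_mat (wreath_graph G1 G2) (d1 + d2) (wreath_verts vs1 vs2)"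
    unfolding assms(9,12)
    using assms(1,4) by (intro wreath_mat_norm_adj assms) (auto simp: finite_multigraph_def)
qed

end
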